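(* For every integer $n\ge0$ and every real $x$ with $1+\lambda x>0$, \[ B_{n,\lambda}(x)=\frac{1}{e_\lambda(x)}(XD)_{n,\lambda}\,e_\lambda(x), \] where $e_\lambda(x)=(1+\lambda x)^{1/\lambda}$ is regarded as a function of $x$.
   Context: Let $\lambda$ be a fixed nonzero real number. The degenerate falling factorial is $(x)_{0,\lambda}=1$ and $(x)_{n,\lambda}=x(x-\lambda)\cdots(x-(n-1)\lambda)$ for $n\ge1$. The degenerate exponential is $e_\lambda^{x}(t)=(1+\lambda t)^{x/\lambda}=\sum_{n\ge0}(x)_{n,\lambda}\frac{t^n}{n!}$, and $e_\lambda(t)=e_\lambda^1(t)$. For real $x$ with $1+\lambda x>0$, the fully degenerate Bell polynomials $B_{n,\lambda}(x)$ are defined by the formal power series identity in $t$ \[ \frac{1}{e_\lambda(x)}\,e_\lambda\big(x e_\lambda(t)\big)=\sum_{n=0}^\infty B_{n,\lambda}(x)\frac{t^n}{n!},\qquad e_\lambda\big(xe_\lambda(t)\big)=\big(1+\lambda x e_\lambda(t)\big)^{1/\lambda}. \] On smooth functions of $x$ (on the interval $1+\lambda x>0$), $X$ denotes multiplication by $x$, $D=\frac{d}{dx}$, and $(XD)_{n,\lambda}=\prod_{i=0}^{n-1}(XD-i\lambda)$ (the identity operator for $n=0$). *)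

theory Defs
  imports "HOL-Analysis.Analysis"
begin

(* The parameter lambda is written l. *)
definition deg_ffact :: "real \<Rightarrow> real \<Rightarrow> nat \<Rightarrow> real" where
  "deg_ffact l x n = (\<Prod>i<n. x - real i * l)"

(* e_lambda^x(t) as a formal power series in t. *)
definition deg_exp_fps :: "real \<Rightarrow> real \<Rightarrow> real fps" where
  "deg_exp_fps l x = Abs_fps (\<lambda>n. deg_ffact l x n / fact n)"

(* e_lambda(x) as a real function; meaningful for 1 + lambda x > 0. *)
definition deg_exp :: "real \<Rightarrow> real \<Rightarrow> real" where
  "deg_exp l x = (1 + l * x) powr (1 / l)"

(* Real power F^a of a formal power series with constant term c > 0:
   write F = c (1 + G) with G of zero constant term, and put
   F^a = c^a (1 + G)^a, where (1 + G)^a is the binomial series at G. *)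
definition fps_powr :: "real fps \<Rightarrow> real \<Rightarrow> real fps" where
  "fps_powr F a = fps_const ((fps_nth F 0) powr a) *
     (fps_binomial a oo (fps_const (inverse (fps_nth F 0)) * F - 1))"

lemma fps_powr_1:
  assumes "fps_nth F 0 > 0"
  shows "fps_powr F 1 = F"
proof -
  have "fps_powr F 1 = fps_const (fps_nth F 0) * (fps_const (inverse (fps_nth F 0)) * F)"
    using assms by (simp add: fps_powr_def fps_binomial_1 fps_compose_add_distrib)
  also have "\<dots> = F"
    using assms by (simp flip: mult.assoc)
  finally show ?thesis .
qed

lemma fps_powr_add:
  assumes "fps_nth F 0 > 0"
  shows "fps_powr F (a + b) = fps_powr F a * fps_powr F b"
proof -
  let ?G = "fps_const (inverse (fps_nth F 0)) * F - 1"
  have "fps_nth ?G 0 = 0" using assms by simp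
  then have "fps_binomial (a + b) oo ?G = (fps_binomial a oo ?G) * (fps_binomial b oo ?G)"
    by (simp add: fps_binomial_add_mult fps_compose_mult_distrib)
  then show ?thesis
    by (simp add: fps_powr_def powr_add mult_ac flip: fps_const_mult)
qed

(* e_lambda^x(t) = (1 + lambda t)^(x/lambda), so the two descriptions of the degenerate exponential agree. *)
lemma deg_exp_fps_eq_powr:
  assumes "l \<noteq> 0"
  shows "deg_exp_fps l x = fps_powr (1 + fps_const l * fps_X) (x / l)"
proof (rule fps_ext)
  fix n
  have "deg_ffact l x n = (\<Prod>i<n. l * (x / l - real i))"
    using assms by (simp add: deg_ffact_def algebra_simps)
  also have "\<dots> = l ^ n * (\<Prod>i<n. x / l - real i)"
    by (simp add: prod.distrib)
  also have "\<dots> = l ^ n * (fact n * ((x / l) gchoose n))"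
    by (simp add: gbinomial_prod_rev lessThan_atLeast0)
  finally have "deg_ffact l x n / fact n = l ^ n * ((x / l) gchoose n)" by simp
  then show "fps_nth (deg_exp_fps l x) n = fps_nth (fps_powr (1 + fps_const l * fps_X) (x / l)) n"
    by (simp add: deg_exp_fps_def fps_powr_def fps_compose_linear)
qed

(* B_{n,lambda}(x), read off as n! times the coefficient of t^n in
   e_lambda(x)^{-1} (1 + lambda x e_lambda(t))^(1/lambda); the power is a genuine one for 1 + lambda x > 0. *)
definition deg_bell :: "real \<Rightarrow> nat \<Rightarrow> real \<Rightarrow> real" where
  "deg_bell l n x = fact n * fps_nth
     (fps_const (1 / deg_exp l x) *
      fps_powr (1 + fps_const (l * x) * deg_exp_fps l 1) (1 / l)) n"

lemma deg_bell_egf: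
  "fps_const (1 / deg_exp l x) *
     fps_powr (1 + fps_const (l * x) * deg_exp_fps l 1) (1 / l)
   = Abs_fps (\<lambda>n. deg_bell l n x / fact n)"
  by (simp add: fps_eq_iff deg_bell_def)

definition X_op :: "(real \<Rightarrow> real) \<Rightarrow> real \<Rightarrow> real" where
  "X_op f = (\<lambda>x. x * f x)"

(* (XD)_{n,lambda}. The factors XD - i lambda commute on smooth functions, so their order
   is immaterial. Functions are total, but the value at a point only depends on the
   function near that point, so on an open interval where f is smooth this is the
   usual operator; elsewhere deriv may be unspecified. *)
primrec XD_ffact :: "real \<Rightarrow> nat \<Rightarrow> (real \<Rightarrow> real) \<Rightarrow> real \<Rightarrow> real" where
  "XD_ffact l 0 f = f"
| "XD_ffact l (Suc n) f =
     (\<lambda>x. X_op (deriv (XD_ffact l n f)) x - real n * l * XD_ffact l n f x)"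

end

(*
  With e = e_lambda(t), factoring 1 + lambda x e = (1 + lambda x) (1 + u (e - 1)) for
  u = lambda x / (1 + lambda x) writes the t^n coefficient of e_lambda(x e) as the finite sum
  over k of [t^n] (e - 1)^k times T_k(x) = binom(1/lambda, k) (lambda x)^k (1 + lambda x)^(1/lambda - k).
  Both factors obey two-term recurrences, x T_k' = k T_k + (k + 1) T_(k+1) and
  (1 + lambda t) d/dt (e - 1)^k = k (e - 1)^k + k (e - 1)^(k-1). Together they give
  (1 + lambda t) d/dt e_lambda(x e) = x d/dx e_lambda(x e) coefficientwise in t, and this is
  the recursion that defines (XD)_(n,lambda).
*)
theory Submission
  imports Defs
begin

text \<open>Coefficientwise this is the step from \<open>deg_ffact l x n\<close> to
  \<open>deg_ffact l x (Suc n)\<close>, whose new factor is \<open>x - real n * l\<close>.\<close>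

lemma deg_exp_fps_deriv:
  "(1 + fps_const l * fps_X) * fps_deriv (deg_exp_fps l x) = fps_const x * deg_exp_fps l x"
proof (rule fps_ext)
  fix n
  have rec: "real (Suc n) * fps_nth (deg_exp_fps l x) (Suc n)
      = (x - real n * l) * fps_nth (deg_exp_fps l x) n" for n
    by (simp add: deg_exp_fps_def deg_ffact_def field_simps del: of_nat_Suc)
  show "fps_nth ((1 + fps_const l * fps_X) * fps_deriv (deg_exp_fps l x)) n
      = fps_nth (fps_const x * deg_exp_fps l x) n"
    using rec[of n] by (cases n) (auto simp: algebra_simps)
qed

text \<open>Up to the factor \<open>fact k / fact n\<close> these are the degenerate Stirling
  numbers of the second kind.\<close>

definition deg_exp_minus_one_power_coeff :: "real \<Rightarrow> nat \<Rightarrow> nat \<Rightarrow> real" where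
  "deg_exp_minus_one_power_coeff l k n = fps_nth ((deg_exp_fps l 1 - 1) ^ k) n"

lemma deg_exp_fps_nth_0: "fps_nth (deg_exp_fps l x) 0 = 1"
  by (simp add: deg_exp_fps_def deg_ffact_def)

text \<open>The series \<open>deg_exp_fps l 1 - 1\<close> has no constant term. This is what later
  allows sums over k to end at n or at \<open>Suc n\<close> alike.\<close>

lemma deg_exp_minus_one_power_coeff_eq_0:
  "n < k \<Longrightarrow> deg_exp_minus_one_power_coeff l k n = 0"
  unfolding deg_exp_minus_one_power_coeff_def
  by (rule startsby_zero_power_prefix[rule_format]) (simp_all add: deg_exp_fps_nth_0)

lemma deg_exp_minus_one_power_coeff_rec_0:
  "real (Suc n) * deg_exp_minus_one_power_coeff l 0 (Suc n)
     + real n * l * deg_exp_minus_one_power_coeff l 0 n = 0"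
  by (cases n) (simp_all add: deg_exp_minus_one_power_coeff_def)

lemma deg_exp_minus_one_power_coeff_rec_Suc:
  "real (Suc n) * deg_exp_minus_one_power_coeff l (Suc k) (Suc n)
     + real n * l * deg_exp_minus_one_power_coeff l (Suc k) n
   = real (Suc k) * (deg_exp_minus_one_power_coeff l (Suc k) n
     + deg_exp_minus_one_power_coeff l k n)"
proof -
  let ?E = "deg_exp_fps l 1 - 1"
  have "(1 + fps_const l * fps_X) * fps_deriv (?E ^ Suc k)
      = of_nat (Suc k) * ?E ^ k * ((1 + fps_const l * fps_X) * fps_deriv (deg_exp_fps l 1))"
    by (simp add: fps_deriv_power' del: power_Suc of_nat_Suc)
  \<comment> \<open>The differential equation at x = 1 turns the last factor into e itself, which
    splits as (e - 1) + 1.\<close>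
  also have "\<dots> = of_nat (Suc k) * (?E ^ Suc k + ?E ^ k)"
    unfolding deg_exp_fps_deriv by (simp add: algebra_simps del: of_nat_Suc)
  finally have "fps_nth ((1 + fps_const l * fps_X) * fps_deriv (?E ^ Suc k)) n
      = fps_nth (fps_const (real (Suc k)) * (?E ^ Suc k + ?E ^ k)) n"
    by (simp only: fps_of_nat)
  then show ?thesis
    unfolding deg_exp_minus_one_power_coeff_def fps_mult_left_const_nth fps_add_nth
    by (cases n) (simp_all add: distrib_right mult.assoc mult.left_commute del: power_Suc of_nat_Suc)
qed

text \<open>For f(x) = (1 + l x)^a this is the Taylor term x^k f^(k)(x) / k!, the coefficient of (e
  - 1)^k in the expansion of f(x e) around x.\<close>

definition binomial_powr_term :: "real \<Rightarrow> real \<Rightarrow> nat \<Rightarrow> real \<Rightarrow> real" where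
  "binomial_powr_term a l k x =
     (a gchoose k) * (l * x) ^ k * (1 + l * x) powr (a - real k)"

text \<open>Only x times the derivative has a clean form, and at x = 0 it does not determine the
  derivative; hence the existential \<open>d\<close>.\<close>

lemma binomial_powr_term_deriv:
  assumes "1 + l * x > 0"
  shows "\<exists>d. (binomial_powr_term a l k has_real_derivative d) (at x) \<and>
     x * d = real k * binomial_powr_term a l k x
       + real (Suc k) * binomial_powr_term a l (Suc k) x"
proof (intro exI conjI)
  let ?p = "(1 + l * x) powr (a - real (Suc k))"
  let ?d = "(a gchoose k) * (real k * l * (l * x) ^ (k - 1) * (1 + l * x) powr (a - real k)
      + (l * x) ^ k * ((a - real k) * l * ?p))"
  show "(binomial_powr_term a l k has_real_derivative ?d) (at x)"
    unfolding binomial_powr_term_def using assms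
    by (auto intro!: derivative_eq_intros simp: distrib_left diff_diff_eq mult_ac add_ac)
  have absorb: "real (Suc k) * (a gchoose Suc k) = (a - real k) * (a gchoose k)"
    using gbinomial_mult_1[of a k] by (simp add: algebra_simps)
  \<comment> \<open>For k = 0 the exponent \<open>k - 1\<close> truncates to 0, but the factor
    \<open>real k\<close> makes both sides vanish.\<close>
  have pow: "real k * (l * x * (l * x) ^ (k - 1)) = real k * (l * x) ^ k"
    by (cases k) simp_all
  have "x * ?d = (a gchoose k) * (1 + l * x) powr (a - real k) * (real k * (l * x * (l * x) ^ (k - 1)))
      + (a - real k) * (a gchoose k) * (l * x) ^ Suc k * ?p"
    by (simp add: algebra_simps)
  also have "\<dots> = real k * binomial_powr_term a l k x
      + real (Suc k) * (a gchoose Suc k) * (l * x) ^ Suc k * ?p"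
    unfolding pow absorb by (simp add: binomial_powr_term_def)
  finally show "x * ?d = real k * binomial_powr_term a l k x
       + real (Suc k) * binomial_powr_term a l (Suc k) x"
    by (simp add: binomial_powr_term_def mult.assoc)
qed

lemma fps_powr_deg_exp_fps_nth:
  assumes "1 + l * x > 0"
  shows "fps_nth (fps_powr (1 + fps_const (l * x) * deg_exp_fps l 1) a) n
    = (\<Sum>k\<le>n. deg_exp_minus_one_power_coeff l k n * binomial_powr_term a l k x)"
proof -
  let ?c = "1 + l * x" and ?E = "deg_exp_fps l 1 - 1"
  have "fps_const (inverse ?c) * (1 + fps_const (l * x) * deg_exp_fps l 1)
      = fps_const (inverse ?c) * (fps_const ?c + fps_const (l * x) * ?E)"
    by (simp add: algebra_simps flip: fps_const_add)
  also have "\<dots> = 1 + fps_const (l * x / ?c) * ?E"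
    using assms by (simp add: distrib_left divide_inverse mult.commute flip: mult.assoc)
  finally have "fps_powr (1 + fps_const (l * x) * deg_exp_fps l 1) a
      = fps_const (?c powr a) * (fps_binomial a oo (fps_const (l * x / ?c) * ?E))"
    by (simp add: fps_powr_def deg_exp_fps_nth_0)
  \<comment> \<open>The composition contributes (l x / c)^k with c = 1 + l x; its denominator merges
    with c^a into c^(a - k).\<close>
  then show ?thesis using assms
    by (simp add: fps_compose_nth power_mult_distrib fps_const_power sum_distrib_left atLeast0AtMost
        deg_exp_minus_one_power_coeff_def binomial_powr_term_def powr_diff powr_realpow
        power_divide mult_ac)
qed

lemma XD_ffact_deg_exp:
  assumes "1 + l * x > 0"
  shows "XD_ffact l n (deg_exp l) x =
    fact n * (\<Sum>k\<le>n. deg_exp_minus_one_power_coeff l k n * binomial_powr_term (1 / l) l k x)"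
  using assms
proof (induction n arbitrary: x)
  case 0
  then show ?case
    by (simp add: deg_exp_minus_one_power_coeff_def binomial_powr_term_def deg_exp_def)
next
  case (Suc n)
  let ?s = "deg_exp_minus_one_power_coeff l"
  let ?T = "binomial_powr_term (1 / l) l"
  obtain d where d: "\<And>k. (?T k has_real_derivative d k) (at x)"
    and xd: "\<And>k. x * d k = real k * ?T k x + real (Suc k) * ?T (Suc k) x"
    using binomial_powr_term_deriv[OF Suc.prems] by metis
  have "((\<lambda>y. fact n * (\<Sum>k\<le>n. ?s k n * ?T k y)) has_real_derivative
      fact n * (\<Sum>k\<le>n. ?s k n * d k)) (at x)"
    by (intro DERIV_cmult DERIV_sum d)
  \<comment> \<open>The induction hypothesis holds on a whole neighbourhood of x, so it may be
    differentiated at x.\<close>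
  moreover have "open {y. 1 + l * y > 0}"
    by (intro open_Collect_less continuous_intros)
  ultimately have "(XD_ffact l n (deg_exp l) has_real_derivative
      fact n * (\<Sum>k\<le>n. ?s k n * d k)) (at x)"
    by (rule has_field_derivative_transform_within_open) (use Suc in auto)
  then have "XD_ffact l (Suc n) (deg_exp l) x =
      fact n * ((\<Sum>k\<le>n. ?s k n * (x * d k)) - real n * l * (\<Sum>k\<le>n. ?s k n * ?T k x))"
    using Suc by (simp add: X_op_def DERIV_imp_deriv sum_distrib_left algebra_simps)
  \<comment> \<open>The added term k = \<open>Suc n\<close> is zero, since
    \<open>?s (Suc n) n\<close> vanishes.\<close>
  also have "(\<Sum>k\<le>n. ?s k n * (x * d k))
      = (\<Sum>k\<le>Suc n. real k * ?s k n * ?T k x) + (\<Sum>k\<le>n. real (Suc k) * ?s k n * ?T (Suc k) x)"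
    by (simp add: xd deg_exp_minus_one_power_coeff_eq_0 algebra_simps sum.distrib)
  \<comment> \<open>The k = 0 term of the first sum carries the factor 0, so shifting its index
    aligns both sums on \<open>?T (Suc k) x\<close>.\<close>
  also have "\<dots> = (\<Sum>k\<le>n. real (Suc k) * (?s (Suc k) n + ?s k n) * ?T (Suc k) x)"
    by (simp add: sum.atMost_Suc_shift algebra_simps sum.distrib del: sum.atMost_Suc)
  also have "\<dots> = (\<Sum>k\<le>Suc n. (real (Suc n) * ?s k (Suc n) + real n * l * ?s k n) * ?T k x)"
    unfolding sum.atMost_Suc_shift deg_exp_minus_one_power_coeff_rec_0
      deg_exp_minus_one_power_coeff_rec_Suc by simp
  also have "\<dots> = real (Suc n) * (\<Sum>k\<le>Suc n. ?s k (Suc n) * ?T k x)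
      + real n * l * (\<Sum>k\<le>Suc n. ?s k n * ?T k x)"
    by (simp add: sum_distrib_left sum.distrib distrib_right mult.assoc
        del: sum.atMost_Suc of_nat_Suc)
  \<comment> \<open>Cut back to n, this sum cancels against the \<open>- real n * l\<close> part of
    the operator.\<close>
  also have "(\<Sum>k\<le>Suc n. ?s k n * ?T k x) = (\<Sum>k\<le>n. ?s k n * ?T k x)"
    by (simp add: deg_exp_minus_one_power_coeff_eq_0)
  finally show ?case
    by (simp add: mult_ac del: sum.atMost_Suc of_nat_Suc)
qed

theorem theorem2p4:
  fixes l x :: real and n :: nat
  assumes "l \<noteq> 0" and "1 + l * x > 0"
  shows "deg_bell l n x = 1 / deg_exp l x * XD_ffact l n (deg_exp l) x"
  \<comment> \<open>Both sides become \<open>fact n / deg_exp l x\<close> times the same sum over k,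
    taken at a = 1 / l.\<close>
  using assms(2) by (simp add: deg_bell_def XD_ffact_deg_exp fps_powr_deg_exp_fps_nth)

end
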